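(* Let $\sigma\in\mathfrak{S}_n$ be a permutation with $k$ cycles. Under the $\mathfrak{S}_n$-action on Bernardi trees on $n$ nodes, the number of Bernardi trees fixed by $\sigma$ equals $$\frac{1}{2^k}\sum_{m=1}^{n+1}m^{k-1}\binom{n}{m-1}.$$
   Context: A (plane binary) tree is a rooted tree in which every node has at most one left child and at most one right child (it may have only one of the two), and no other children. A Bernardi tree on $n$ nodes is a tree on $n$ nodes, labeled bijectively by $[n]$, such that every internal (non-terminal) node has a label greater than that of its right child if it has a right child, and otherwise greater than that of its left child. Preorder here visits the root, then recursively the right subtree in preorder, then the left subtree in preorder. Let $v_1,\dots,v_n$ be the nodes of a Bernardi tree $T$ in preorder, with labels $v_1^\ell,\dots,v_n^\ell$, let $v_{i_1},\dots,v_{i_k}$ with $i_1<\cdots<i_k=n$ be the terminal nodes (nodes with no children), and put $i_0=0$. The word $v_1^\ell\cdots v_n^\ell$ factors as $W_1\cdots W_k$ with $W_j=v_{i_{j-1}+1}^\ell\cdots v_{i_j}^\ell$, and each $W_j$ is strictly decreasing. The $\mathfrak{S}_n$-action: for $\sigma\in\mathfrak{S}_n$ let $\widetilde\sigma(W_j)$ be obtained by applying $\sigma$ to every letter of $W_j$ and sorting the result into decreasing order; $\sigma(T)$ is the labeled tree with the same underlying unlabeled tree as $T$ and with preorder word $\widetilde\sigma(W_1)\cdots\widetilde\sigma(W_k)$. (It is again a Bernardi tree.) The number of cycles of a permutation includes fixed points. *)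

theory Defs
  imports
    "HOL-Library.Tree"
    "HOL-Combinatorics.Permutations"
    "HOL-Combinatorics.Orbits"
    Complex_Main
begin

text \<open>
  A plane binary tree is an element of \<^typ>\<open>'a tree\<close>; the constructor \<^const>\<open>Leaf\<close> is not a node
  but marks an absent child, so \<^term>\<open>size T\<close> is the number of nodes.
  A node is represented by the subtree rooted at it, its label being \<^const>\<open>value\<close> of that subtree.
\<close>

text \<open>This preorder visits the right subtree before the left one, unlike \<^const>\<open>preorder\<close>.\<close>

fun nodes :: "'a tree \<Rightarrow> 'a tree list" where
  "nodes \<langle>\<rangle> = []"
| "nodes \<langle>l, a, r\<rangle> = \<langle>l, a, r\<rangle> # nodes r @ nodes l"

definition preorder_word :: "'a tree \<Rightarrow> 'a list" where
  "preorder_word T = map value (nodes T)"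

definition terminal :: "'a tree \<Rightarrow> bool" where
  "terminal v \<longleftrightarrow> left v = \<langle>\<rangle> \<and> right v = \<langle>\<rangle>"

definition bernardi_trees :: "nat \<Rightarrow> nat tree set" where
  "bernardi_trees n = {T. size T = n \<and>
     distinct (preorder_word T) \<and> set (preorder_word T) = {1..n} \<and>
     (\<forall>v \<in> set (nodes T). \<not> terminal v \<longrightarrow>
        (if right v \<noteq> \<langle>\<rangle> then value (right v) < value v else value (left v) < value v))}"

text \<open>Cuts a list immediately after each element that satisfies \<open>P\<close>.\<close>

fun cut_after :: "('a \<Rightarrow> bool) \<Rightarrow> 'a list \<Rightarrow> 'a list list" where
  "cut_after P [] = []"
| "cut_after P (x # xs) =
     (if P x then [x] # cut_after P xs
      else case cut_after P xs of [] \<Rightarrow> [[x]] | w # ws \<Rightarrow> (x # w) # ws)"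

text \<open>The last node in preorder is terminal, so every factor ends at a terminal node.\<close>

definition factors :: "'a tree \<Rightarrow> 'a list list" where
  "factors T = map (map value) (cut_after terminal (nodes T))"

definition apply_and_sort :: "(nat \<Rightarrow> nat) \<Rightarrow> nat list \<Rightarrow> nat list" where
  "apply_and_sort \<sigma> w = rev (sort (map \<sigma> w))"

definition shape :: "'a tree \<Rightarrow> unit tree" where
  "shape T = map_tree (\<lambda>_. ()) T"

text \<open>The description is well defined by \<open>ex1_relabelling\<close> and \<open>length_action_word\<close> below.\<close>

definition action :: "(nat \<Rightarrow> nat) \<Rightarrow> nat tree \<Rightarrow> nat tree" where
  "action \<sigma> T = (THE T'. shape T' = shape T \<and>
     preorder_word T' = concat (map (apply_and_sort \<sigma>) (factors T)))"

text \<open>Every point lies in its own orbit, so fixed points count as cycles.\<close>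

definition num_cycles :: "nat \<Rightarrow> (nat \<Rightarrow> nat) \<Rightarrow> nat" where
  "num_cycles n \<sigma> = card (orbit \<sigma> ` {1..n})"

lemma preorder_word_simps [simp]:
  "preorder_word \<langle>\<rangle> = []"
  "preorder_word \<langle>l, a, r\<rangle> = a # preorder_word r @ preorder_word l"
  by (simp_all add: preorder_word_def)

lemma shape_simps [simp]:
  "shape \<langle>\<rangle> = \<langle>\<rangle>" "shape \<langle>l, a, r\<rangle> = \<langle>shape l, (), shape r\<rangle>"
  by (simp_all add: shape_def)

lemma shape_eq_Leaf [simp]: "shape T = \<langle>\<rangle> \<longleftrightarrow> T = \<langle>\<rangle>"
  by (cases T) auto

lemma length_preorder_word [simp]: "length (preorder_word T) = size T"
  by (induction T) auto

lemma size_eq_of_shape: "shape T = shape T' \<Longrightarrow> size T = size T'"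
  by (metis shape_def size_map_tree)

lemma ex1_relabelling:
  assumes "length w = size (T :: 'a tree)"
  shows "\<exists>!T' :: 'b tree. shape T' = shape T \<and> preorder_word T' = w"
proof -
  have "\<exists>T' :: 'b tree. shape T' = shape T \<and> preorder_word T' = w"
    using assms
  proof (induction T arbitrary: w)
    case (Node l x r)
    then obtain a u where w: "w = a # u" "length u = size l + size r" by (cases w) auto
    obtain r' :: "'b tree" where "shape r' = shape r" "preorder_word r' = take (size r) u"
      using Node.IH(2)[of "take (size r) u"] w by auto
    moreover obtain l' :: "'b tree" where "shape l' = shape l" "preorder_word l' = drop (size r) u"
      using Node.IH(1)[of "drop (size r) u"] w by auto
    ultimately show ?case using w by (intro exI[of _ "\<langle>l', a, r'\<rangle>"]) simp
  qed simp
  moreover have "S = S'"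
    if "shape S = shape S'" "preorder_word S = preorder_word S'" for S S' :: "'b tree"
    using that
  proof (induction S arbitrary: S')
    case (Node l x r)
    then obtain l' x' r' where "S' = \<langle>l', x', r'\<rangle>" "shape l = shape l'" "shape r = shape r'"
      by (cases S') auto
    then show ?case using Node size_eq_of_shape[of r r'] by auto
  qed (metis shape_eq_Leaf shape_simps(1))
  ultimately show ?thesis by metis
qed

lemma concat_cut_after [simp]: "concat (cut_after P xs) = xs"
  by (induction xs) (auto split: list.split)

lemma length_action_word: "length (concat (map (apply_and_sort \<sigma>) (factors T))) = size T"
proof -
  have "length (concat (map (apply_and_sort \<sigma>) (factors T))) = length (concat (factors T))"
    by (simp add: length_concat apply_and_sort_def comp_def)
  also have "concat (factors T) = preorder_word T"
    by (simp add: factors_def preorder_word_def flip: map_concat)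
  finally show ?thesis by simp
qed

end

theory Submission
  imports Defs
    "HOL-Combinatorics.Multiset_Permutations"
    "HOL-Combinatorics.Stirling"
    "HOL-Computational_Algebra.Polynomial"
    "HOL-Library.Disjoint_Sets"
begin

text \<open>
  A Bernardi tree amounts to a tree shape together with an ordered partition of \<open>{1..n}\<close> into blocks
  of the sizes prescribed by the factors of the shape, and it is fixed by \<open>\<sigma>\<close> iff every block is a
  union of cycles. For an unordered partition into \<open>j\<close> blocks, all orders of the blocks together
  admit \<open>(j - 1)! C(n - j, j - 1) 2^(n - 2 j + 1)\<close> shapes, by a cycle-lemma argument that makes the
  result independent of the block sizes. The number of fixed trees is therefore
  \<open>\<Sum>j. S(k, j) (j - 1)! C(n - j, j - 1) 2^(n - 2 j + 1)\<close>. To evaluate this sum, apply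
  \<open>(y d/dy)^(k - 1)\<close> at \<open>y = 1\<close> to \<open>y\<close> times the Binet formula
  \<open>2 y (\<Sum>i. C(n - 1 - i, i) 2^(n - 1 - 2 i) (y\<^sup>2 - 1)^i) = (1 + y)^n - (1 - y)^n\<close>,
  which annihilates the term \<open>y (1 - y)^n\<close> because \<open>k - 1 < n\<close>.
\<close>

section \<open>A binomial sum with Stirling numbers\<close>

text \<open>Pascal's rule, applied to the coefficient with index \<open>Suc i\<close>, produces the
  two terms of the recurrence. Summands with \<open>2 * i > n\<close> have a zero binomial
  coefficient, so the truncated exponent \<open>n - 2 * i\<close> is harmless there.\<close>

lemma sum_binomial_diagonal_rec:
  fixes p q :: "'a :: comm_ring_1"
  defines "F \<equiv> \<lambda>n. \<Sum>i\<le>n. of_nat ((n - i) choose i) * p ^ (n - 2 * i) * q ^ i"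
  shows "F (Suc (Suc n)) = p * F (Suc n) + q * F n"
proof -
  have 1: "F (Suc (Suc n)) = p ^ Suc (Suc n) +
      (\<Sum>i\<le>n. of_nat ((Suc n - i) choose Suc i) * p ^ (n - 2 * i) * q ^ Suc i)"
    by (simp add: F_def sum.atMost_Suc_shift[of _ "Suc n"] del: sum.atMost_Suc binomial_Suc_Suc)
       (simp add: sum.atMost_Suc)
  have 2: "p * F (Suc n) = p ^ Suc (Suc n) +
      (\<Sum>i\<le>n. of_nat ((n - i) choose Suc i) * p ^ (n - 2 * i) * q ^ Suc i)"
  proof -
    have "p * (of_nat ((n - i) choose Suc i) * p ^ (Suc n - 2 * Suc i) * q ^ Suc i) =
        of_nat ((n - i) choose Suc i) * p ^ (n - 2 * i) * q ^ Suc i" for i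
    \<comment> \<open>For \<open>n \<le> 2 * i\<close> the truncated exponents need not match, but
      then \<open>(n - i) choose Suc i\<close> is zero.\<close>
    proof (cases "2 * i < n")
      case True
      then have "n - 2 * i = Suc (Suc n - 2 * Suc i)" by simp
      then show ?thesis by (simp add: mult_ac)
    qed (simp add: binomial_eq_0)
    then show ?thesis
      by (simp add: F_def sum.atMost_Suc_shift[of _ n] distrib_left sum_distrib_left
          del: sum.atMost_Suc)
  qed
  have 3: "(Suc n - i) choose Suc i = ((n - i) choose i) + ((n - i) choose Suc i)" if "i \<le> n" for i
    using that by (simp add: Suc_diff_le)
  have "(\<Sum>i\<le>n. of_nat ((Suc n - i) choose Suc i) * p ^ (n - 2 * i) * q ^ Suc i) =
      q * F n + (\<Sum>i\<le>n. of_nat ((n - i) choose Suc i) * p ^ (n - 2 * i) * q ^ Suc i)"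
    unfolding F_def sum_distrib_left sum.distrib[symmetric]
    by (rule sum.cong) (simp_all only: atMost_iff 3 of_nat_add, simp_all add: algebra_simps)
  with 1 2 show ?thesis by simp
qed

text \<open>A Binet formula: \<open>1 + y\<close> and \<open>1 - y\<close> are the roots of \<open>x\<^sup>2 = 2x + (y\<^sup>2 - 1)\<close>.\<close>

lemma sum_binomial_diagonal_Binet:
  fixes y :: "'a :: comm_ring_1"
  shows "2 * y * (\<Sum>i\<le>n. of_nat ((n - i) choose i) * 2 ^ (n - 2 * i) * (y\<^sup>2 - 1) ^ i) =
    (1 + y) ^ Suc n - (1 - y) ^ Suc n"
proof (induction n rule: less_induct)
  case (less n)
  consider "n = 0" | "n = 1" | m where "n = Suc (Suc m)"
    by (metis One_nat_def old.nat.exhaust)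
  then show ?case
  proof cases
    case 3
    have "2 * y * (2 * a + (y\<^sup>2 - 1) * b) = 2 * (2 * y * a) + (y\<^sup>2 - 1) * (2 * y * b)" for a b
      by (simp add: algebra_simps)
    then show ?thesis
      unfolding 3 sum_binomial_diagonal_rec
      by (simp only: less.IH 3 less_Suc_eq lessI simp_thms)
         (simp add: algebra_simps power2_eq_square)
  qed (simp_all add: algebra_simps power2_eq_square)
qed

section \<open>The Euler operator on polynomials and its iterates evaluated at 1\<close>

definition euler_op :: "real poly \<Rightarrow> real poly" where
  "euler_op p = [:0, 1:] * pderiv p"

text \<open>On a polynomial with coefficients \<open>c m\<close> this is the power sum of
  \<open>m ^ q * c m\<close>, the \<open>q\<close>-th moment of the coefficient sequence.\<close>

definition moment :: "nat \<Rightarrow> real poly \<Rightarrow> real" where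
  "moment q p = poly ((euler_op ^^ q) p) 1"

lemma moment_0 [simp]: "moment 0 p = poly p 1"
  by (simp add: moment_def)

lemma moment_Suc [simp]: "moment (Suc q) p = moment q (euler_op p)"
  by (simp add: moment_def funpow_swap1)

lemma moment_add: "moment q (a + b) = moment q a + moment q b"
  by (induction q arbitrary: a b) (simp_all add: euler_op_def pderiv_add distrib_left del: mult_pCons_left)

lemma moment_smult: "moment q (smult c a) = c * moment q a"
  by (induction q arbitrary: a) (simp_all add: euler_op_def pderiv_smult del: mult_pCons_left)

lemma moment_zero: "moment q 0 = 0"
  using moment_smult[of q 0 0] by simp

lemma moment_sum: "moment q (\<Sum>i\<in>I. f i) = (\<Sum>i\<in>I. moment q (f i))"
  by (induction I rule: infinite_finite_induct) (simp_all add: moment_add moment_zero)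

text \<open>Monomials are eigenvectors of the Euler operator, with their degree as
  eigenvalue.\<close>

lemma moment_monom: "moment q (monom 1 m) = real m ^ q"
proof (induction q)
  case (Suc q)
  have "euler_op (monom 1 m) = smult (real m) (monom 1 m)"
    by (cases m) (simp_all add: euler_op_def pderiv_monom smult_monom flip: monom_Suc)
  with Suc show ?case by (simp add: moment_smult)
qed (simp add: poly_monom)

text \<open>One application of the Euler operator lowers the order of the zero at 1 by at most one,
  so after \<open>q < n\<close> applications a zero remains. The cofactor \<open>p\<close> is
  arbitrary because it changes at each step of the induction.\<close>

lemma moment_root_power: "q < n \<Longrightarrow> moment q ([:1, -1:] ^ n * p) = 0"
proof (induction q arbitrary: n p)
  case (Suc q)
  then obtain m where m: "n = Suc m" "q < m" by (cases n) auto
  define u :: "real poly" where "u = [:1, -1:]"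
  have "pderiv u = - 1" by (simp add: u_def pderiv_pCons one_pCons)
  then have "euler_op (u ^ n * p) = u ^ m * ([:0, 1:] * (u * pderiv p - smult (real n) p))"
    unfolding euler_op_def m pderiv_mult pderiv_power_Suc
    by (simp add: algebra_simps del: mult_pCons_left mult_pCons_right)
  then show ?case
    using Suc.IH[OF m(2)] by (simp only: moment_Suc u_def)
qed auto

text \<open>The Euler operator maps \<open>r i\<close> to \<open>2 * (i + 1)\<close> times
  \<open>r i\<close> plus \<open>2 * i\<close> times \<open>r (i - 1)\<close>. After division by
  \<open>2 ^ q\<close> and \<open>fact i\<close>, this is the recurrence of the Stirling numbers of
  the second kind.\<close>

lemma moment_Stirling:
  "moment q ([:0, 1:]\<^sup>2 * ([:0, 1:]\<^sup>2 - 1) ^ i) = 2 ^ q * real (Stirling (Suc q) (Suc i)) * fact i"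
proof (induction q arbitrary: i)
  case (Suc q)
  define r where "r i = [:0, 1:]\<^sup>2 * ([:0, 1:]\<^sup>2 - 1 :: real poly) ^ i" for i
  have IH: "moment q (r i) = 2 ^ q * real (Stirling (Suc q) (Suc i)) * fact i" for i
    using Suc by (simp only: r_def)
  have 1: "euler_op (r i) = smult (2 * real (Suc i)) (r i) + smult (2 * real i) (r (i - 1))"
  proof (cases i)
    case 0
    then show ?thesis
      by (simp add: r_def euler_op_def power2_eq_square pderiv_pCons)
  next
    case (Suc j)
    define u :: "real poly" where "u = [:0, 1:]\<^sup>2 - 1"
    have d: "pderiv u = smult 2 [:0, 1:]" "pderiv ([:0, 1:]\<^sup>2 :: real poly) = smult 2 [:0, 1:]"
      by (simp_all add: u_def power2_eq_square pderiv_diff pderiv_pCons)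
    \<comment> \<open>The term with \<open>u ^ j\<close> arises from writing one factor
      \<open>X\<^sup>2\<close> as \<open>u + 1\<close>. Scalars are turned into constant
      polynomials, which leaves an identity in a commutative ring.\<close>
    have *: "X * (X\<^sup>2 * (smult c (u ^ j) * smult 2 X) + u ^ Suc j * smult 2 X) =
        smult (2 * (1 + c)) (X\<^sup>2 * u ^ Suc j) + smult (2 * c) (X\<^sup>2 * u ^ j)"
      if "u = X\<^sup>2 - 1" for X :: "real poly" and c
    proof -
      have ring: "X * (X\<^sup>2 * (C * w * (2 * X)) + (X\<^sup>2 - 1) * w * (2 * X)) =
          2 * (1 + C) * (X\<^sup>2 * ((X\<^sup>2 - 1) * w)) + 2 * C * (X\<^sup>2 * w)" for C w :: "real poly"
        by (simp add: algebra_simps power2_eq_square)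
      have sc: "smult a p = [:a:] * p" for a and p :: "real poly" by simp
      have e: "[:2 * (1 + c):] = 2 * (1 + [:c:])" "[:2:] = (2 :: real poly)" "[:2 * c:] = 2 * [:c:]"
        by (simp_all add: numeral_poly one_pCons)
      show ?thesis
        unfolding sc e power_Suc using ring[of "[:c:]" "u ^ j"] by (simp only: that)
    qed
    show ?thesis
      unfolding r_def euler_op_def Suc pderiv_mult pderiv_power_Suc u_def[symmetric] d
      using *[OF u_def, of "real (Suc j)"] by (simp only: diff_Suc_1 of_nat_Suc)
  qed
  have "moment (Suc q) (r i) = 2 * real (Suc i) * moment q (r i) + 2 * real i * moment q (r (i - 1))"
    by (simp add: 1 moment_add moment_smult del: of_nat_Suc)
  also have "\<dots> = 2 ^ Suc q * real (Stirling (Suc (Suc q)) (Suc i)) * fact i"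
    unfolding IH by (cases i) (simp_all add: algebra_simps)
  finally show ?case by (simp add: r_def)
next
  case 0
  show ?case by (cases i) simp_all
qed

lemma sum_power_binomial_Stirling:
  assumes "1 \<le> k" "k \<le> n"
  shows "(\<Sum>m = 1..n + 1. real m ^ (k - 1) * real (n choose (m - 1))) =
    2 ^ k * (\<Sum>i\<le>n - 1. real (((n - 1 - i) choose i) * 2 ^ (n - 1 - 2 * i) * (Stirling k (Suc i) * fact i)))"
proof -
  define X :: "real poly" where "X = [:0, 1:]"
  define q where "q = k - 1"
  obtain N where N: "n = Suc N" using assms by (cases n) auto
  have k: "k = Suc q" "q < n" using assms by (simp_all add: q_def)
  \<comment> \<open>The extra factor \<open>X\<close> shifts the exponents to
    \<open>m = i + 1\<close>, so that the moment pairs \<open>m ^ (k - 1)\<close> with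
    \<open>n choose (m - 1)\<close>.\<close>
  have "X * (1 + X) ^ n = (\<Sum>i\<le>n. smult (real (n choose i)) (monom 1 (Suc i)))"
    unfolding add.commute[of 1] binomial_ring sum_distrib_left
    by (rule sum.cong) (simp_all add: X_def monom_altdef of_nat_poly mult_ac)
  then have "moment q (X * (1 + X) ^ n) = (\<Sum>i\<le>n. real (n choose i) * real (Suc i) ^ q)"
    by (simp add: moment_sum moment_smult moment_monom del: of_nat_Suc)
  also have "\<dots> = (\<Sum>m = 1..n + 1. real m ^ (k - 1) * real (n choose (m - 1)))"
    unfolding sum.atLeast1_atMost_eq Suc_eq_plus1[symmetric] One_nat_def
    by (simp add: k lessThan_Suc_atMost mult.commute del: of_nat_Suc)
  finally have 1: "moment q (X * (1 + X) ^ n) = \<dots>" .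
  have "(1 - X) = [:1, -1:]" by (simp add: X_def one_pCons)
  then have "moment q ((1 - X) ^ n * X) = 0"
    using k moment_root_power by simp
  \<comment> \<open>This is the Binet formula times \<open>X\<close>; the second \<open>X\<close> on
    its left side completes the polynomials of \<open>moment_Stirling\<close>. The scalar 2 and
    their factor \<open>2 ^ q\<close> combine to \<open>2 ^ k\<close>.\<close>
  moreover have "X * (1 + X) ^ n = smult 2 (\<Sum>i\<le>N. smult (real (((N - i) choose i) * 2 ^ (N - 2 * i))) (X\<^sup>2 * (X\<^sup>2 - 1) ^ i))
      + (1 - X) ^ n * X"
  proof -
    have "X * (2 * X * (\<Sum>i\<le>N. of_nat ((N - i) choose i) * 2 ^ (N - 2 * i) * (X\<^sup>2 - 1) ^ i)) =
      X * ((1 + X) ^ n - (1 - X) ^ n)"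
      unfolding N sum_binomial_diagonal_Binet ..
    moreover have "smult 2 (\<Sum>i\<le>N. smult (real (((N - i) choose i) * 2 ^ (N - 2 * i))) (X\<^sup>2 * (X\<^sup>2 - 1) ^ i)) =
      X * (2 * X * (\<Sum>i\<le>N. of_nat ((N - i) choose i) * 2 ^ (N - 2 * i) * (X\<^sup>2 - 1) ^ i))"
    proof -
      have sc: "smult (real c) p = of_nat c * p" for c p by (simp add: of_nat_poly)
      show ?thesis
        unfolding sc sc[of 2, simplified] by (simp add: sum_distrib_left power2_eq_square mult_ac)
    qed
    ultimately show ?thesis by (simp add: algebra_simps)
  qed
  ultimately show ?thesis
    using 1 by (simp add: k N moment_add moment_smult moment_sum X_def moment_Stirling sum_distrib_left mult_ac)
qed

section \<open>Counting forests by the lengths of their factors\<close>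

text \<open>This is the mean \<open>m * t / (m + n)\<close> of a hypergeometric distribution with
  denominators cleared. Absorbing the factor \<open>b\<close> into \<open>m choose b\<close> reduces
  it to the Vandermonde convolution.\<close>

lemma vandermonde_weighted:
  "(\<Sum>b\<le>t. b * (m choose b) * (n choose (t - b))) * (m + n) = m * t * ((m + n) choose t)"
proof (cases "m = 0 \<or> t = 0")
  case False
  then obtain m' t' where *: "m = Suc m'" "t = Suc t'" by (metis not0_implies_Suc)
  have "(\<Sum>b\<le>t. b * (m choose b) * (n choose (t - b))) =
      (\<Sum>b\<le>t'. Suc b * (Suc m' choose Suc b) * (n choose (t' - b)))"
    by (simp add: * sum.atMost_Suc_shift[of _ t'] del: sum.atMost_Suc binomial_Suc_Suc mult_Suc)
  also have "\<dots> = m * (\<Sum>b\<le>t'. (m' choose b) * (n choose (t' - b)))"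
    unfolding Suc_times_binomial sum_distrib_left * by (simp add: mult_ac del: mult_Suc)
  also have "\<dots> = m * ((m' + n) choose t')"
    by (simp add: vandermonde)
  finally have "(\<Sum>b\<le>t. b * (m choose b) * (n choose (t - b))) * (m + n) =
      m * (Suc (m' + n) * ((m' + n) choose t'))"
    by (simp only: * add_Suc mult_ac)
  also have "\<dots> = m * t * ((m + n) choose t)"
    by (simp only: Suc_times_binomial_eq[of "m' + n" t'] * add_Suc mult_ac)
  finally show ?thesis .
qed auto

text \<open>\<open>forest_count as r\<close> is the number of ordered forests of \<open>r\<close> nonempty unlabelled trees
  whose preorder factors have the lengths \<open>as\<close>. A root is either a terminal node, or has one child
  on either side, or has two children.\<close>

function forest_count :: "nat list \<Rightarrow> nat \<Rightarrow> nat" where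
  "forest_count [] r = (if r = 0 then 1 else 0)"
| "forest_count (a # as) 0 = 0"
| "forest_count (0 # as) (Suc r) = 0"
| "forest_count (Suc 0 # as) (Suc r) = forest_count as r"
| "forest_count (Suc (Suc a) # as) (Suc r) =
     2 * forest_count (Suc a # as) (Suc r) + forest_count (Suc a # as) (Suc (Suc r))"
  by pat_completeness auto
termination by (relation "measure (\<lambda>(as, r). sum_list as + length as)") auto

text \<open>Of the \<open>a\<close> nonterminal nodes of the first factor, \<open>b\<close> have two
  children and each adds one pending tree. The other \<open>a - b\<close> have a single child, on
  one of two sides. The terminal node that ends the factor removes one pending tree, which leaves
  \<open>r + b\<close>.\<close>

lemma forest_count_Cons:
  "forest_count (Suc a # as) (Suc r) = (\<Sum>b\<le>a. (a choose b) * 2 ^ (a - b) * forest_count as (r + b))"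
proof (induction a arbitrary: r)
  case (Suc a)
  let ?f = "\<lambda>b. forest_count as (r + b)"
  have "(\<Sum>b\<le>Suc a. (Suc a choose b) * 2 ^ (Suc a - b) * ?f b) =
      2 ^ Suc a * ?f 0 + (\<Sum>b\<le>a. (a choose b) * 2 ^ (a - b) * ?f (Suc b))
        + (\<Sum>b\<le>a. (a choose Suc b) * 2 ^ (a - b) * ?f (Suc b))"
    unfolding sum.atMost_Suc_shift[of _ a] by (simp add: sum.distrib algebra_simps)
  also have "\<dots> = (\<Sum>b\<le>Suc a. (a choose b) * 2 ^ (Suc a - b) * ?f b) +
      (\<Sum>b\<le>a. (a choose b) * 2 ^ (a - b) * ?f (Suc b))"
    unfolding sum.atMost_Suc_shift[of _ a] by simp
  also have "(\<Sum>b\<le>Suc a. (a choose b) * 2 ^ (Suc a - b) * ?f b) =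
      2 * (\<Sum>b\<le>a. (a choose b) * 2 ^ (a - b) * ?f b)"
    by (simp add: sum_distrib_left Suc_diff_le mult_ac)
  finally show ?case using Suc.IH[of r] Suc.IH[of "Suc r"] by simp
qed simp

lemma sum_permutations_of_set_Cons:
  assumes "finite A" "A \<noteq> {}"
  shows "(\<Sum>xs\<in>permutations_of_set A. f xs) =
    (\<Sum>x\<in>A. \<Sum>xs\<in>permutations_of_set (A - {x}). f (x # xs))"
  unfolding permutations_of_set_nonempty[OF assms(2)]
  by (subst sum.UNION_disjoint) (auto simp: assms sum.reindex)

text \<open>A form of the cycle lemma, averaged over all orders of the factors: \<open>M\<close> is the number of
  nonterminal nodes, of which \<open>t\<close> have two children.\<close>

lemma sum_forest_count:
  assumes "finite A" "A \<noteq> {}" "\<And>x. x \<in> A \<Longrightarrow> s x \<ge> 1"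
  shows "(\<Sum>xs\<in>permutations_of_set A. forest_count (map s xs) r) =
    (if r \<le> card A then let M = sum s A - card A; t = card A - r
     in r * fact (card A - 1) * (M choose t) * 2 ^ (M - t) else 0)"
  using assms
proof (induction "card A" arbitrary: A r)
  case (Suc j)
  note fin = \<open>finite A\<close>
  have less: "card (A - {x}) = j" "sum s (A - {x}) = sum s A - s x" "s x \<le> sum s A" if "x \<in> A" for x
    using that Suc.hyps(2) fin by (simp_all add: sum_diff1_nat member_le_sum)
  show ?case
  proof (cases r)
    case 0
    have "forest_count (map s xs) r = 0" if "xs \<in> permutations_of_set A" for xs
      using that \<open>A \<noteq> {}\<close> 0 by (cases xs) (auto simp: permutations_of_set_def)
    then show ?thesis by (simp add: 0)
  next
    case (Suc r')
    \<comment> \<open>The sum is split by the first factor \<open>x\<close>, which is then consumed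
      by \<open>forest_count_Cons\<close>.\<close>
    have *: "(\<Sum>xs\<in>permutations_of_set A. forest_count (map s xs) r) =
      (\<Sum>x\<in>A. \<Sum>b\<le>s x - 1. ((s x - 1) choose b) * 2 ^ (s x - 1 - b) *
        (\<Sum>xs\<in>permutations_of_set (A - {x}). forest_count (map s xs) (r' + b)))"
      (is "?S = _")
      unfolding sum_permutations_of_set_Cons[OF \<open>finite A\<close> \<open>A \<noteq> {}\<close>]
    proof (rule sum.cong)
      fix x assume "x \<in> A"
      then obtain a where a: "s x = Suc a" using Suc.prems(3)[of x] by (cases "s x") auto
      show "(\<Sum>xs\<in>permutations_of_set (A - {x}). forest_count (map s (x # xs)) r) =
          (\<Sum>b\<le>s x - 1. (s x - 1 choose b) * 2 ^ (s x - 1 - b) *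
             (\<Sum>xs\<in>permutations_of_set (A - {x}). forest_count (map s xs) (r' + b)))"
        by (simp add: a Suc forest_count_Cons sum_distrib_left) (rule sum.swap)
    qed simp
    \<comment> \<open>A single factor is treated apart, since the induction hypothesis requires that
      the remaining set be nonempty.\<close>
    show ?thesis
    proof (cases j)
      case 0
      then obtain x where A: "A = {x}" using Suc.hyps(2) by (metis card_1_singletonE One_nat_def)
      then obtain a where a: "s x = Suc a" using Suc.prems(3)[of x] by (cases "s x") auto
      have "?S = (\<Sum>b\<le>a. if r' + b = 0 then (a choose b) * 2 ^ (a - b) else 0)"
        by (auto simp add: A a Suc forest_count_Cons intro!: sum.cong)
      also have "\<dots> = (if r' = 0 then 2 ^ a else 0)"
        by (cases r') (auto simp: sum.delta)
      finally show ?thesis by (simp add: A Suc a)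
    next
      case j: (Suc i)
      define M where "M = sum s A - card A"
      have lenA: "card A \<le> sum s A"
        using sum_mono[of A "\<lambda>_. 1" s] Suc.prems(3) by simp
      have IH: "(\<Sum>xs\<in>permutations_of_set (A - {x}). forest_count (map s xs) (r' + b)) =
          (if r' + b \<le> j then let M = sum s A - s x - j; t = j - (r' + b)
           in (r' + b) * fact i * (M choose t) * 2 ^ (M - t) else 0)" if "x \<in> A" for x b
      proof -
        have "A - {x} \<noteq> {}" using less(1)[OF that] j by (metis card.empty nat.distinct(1))
        from Suc.hyps(1)[OF _ _ this, of "r' + b"] show ?thesis
          using less[OF that] Suc.prems fin j by simp
      qed
      show ?thesis
      proof (cases "r' \<le> j")
        case False
        then show ?thesis
          unfolding * using Suc.hyps(2) Suc by (simp add: IH)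
      next
        case True
        \<comment> \<open>This equals \<open>card A - r\<close>: a node with two children adds a
          pending tree, each of the \<open>card A\<close> terminal nodes removes one, and
          \<open>r\<close> trees are pending at the start.\<close>
        define t where "t = j - r'"
        \<comment> \<open>The powers of two from the first factor and from the rest multiply to
          \<open>2 ^ (M - t)\<close>, independently of \<open>x\<close> and \<open>b\<close>. Where
          truncated subtraction would break this, a binomial coefficient or the induction hypothesis
          makes both sides zero.\<close>
        have inner: "(\<Sum>b\<le>s x - 1. (s x - 1 choose b) * 2 ^ (s x - 1 - b) *
            (\<Sum>xs\<in>permutations_of_set (A - {x}). forest_count (map s xs) (r' + b))) =
          fact i * 2 ^ (M - t) * (\<Sum>b\<le>t. (r' + b) * (s x - 1 choose b) * (M - (s x - 1) choose (t - b)))"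
          if x: "x \<in> A" for x
        proof -
          have sx: "1 \<le> s x" using Suc.prems(3) x by auto
          have "j \<le> sum s (A - {x})"
            using sum_mono[of "A - {x}" "\<lambda>_. 1" s] Suc.prems(3) less(1)[OF x] by simp
          then have M: "sum s A - s x - j = M - (s x - 1)" "s x - 1 \<le> M"
            using less[OF x] Suc.hyps(2) sx unfolding M_def by simp_all
          let ?g = "\<lambda>b. (s x - 1 choose b) * 2 ^ (s x - 1 - b) *
            (\<Sum>xs\<in>permutations_of_set (A - {x}). forest_count (map s xs) (r' + b))"
          let ?h = "\<lambda>b. fact i * 2 ^ (M - t) * ((r' + b) * (s x - 1 choose b) * (M - (s x - 1) choose (t - b)))"
          have "?g b = (if b \<le> t then ?h b else 0)" for b
          proof (cases "b \<le> t \<and> b \<le> s x - 1 \<and> t - b \<le> M - (s x - 1)")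
            case True
            then have "M - t = (s x - 1 - b) + (M - (s x - 1) - (t - b))" using M(2) by arith
            then have "(2::nat) ^ (M - t) = 2 ^ (s x - 1 - b) * 2 ^ (M - (s x - 1) - (t - b))"
              by (simp only: power_add)
            moreover have "r' + b \<le> j" "j - (r' + b) = t - b"
              using True \<open>r' \<le> j\<close> by (auto simp: t_def)
            ultimately show ?thesis
              using True by (simp only: IH[OF x] M(1) Let_def if_True mult_ac)
          next
            case False
            show ?thesis
            proof (cases "b \<le> t")
              case True
              then have zero: "(s x - 1 choose b) = 0 \<or> (M - (s x - 1) choose (t - b)) = 0"
                using False by (auto simp: binomial_eq_0)
              have "r' + b \<le> j" "j - (r' + b) = t - b"
                using True \<open>r' \<le> j\<close> by (auto simp: t_def)
              then have "?g b = (s x - 1 choose b) * 2 ^ (s x - 1 - b) *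
                  ((r' + b) * fact i * (M - (s x - 1) choose (t - b)) * 2 ^ (M - (s x - 1) - (t - b)))"
                by (simp only: IH[OF x] M(1) Let_def if_True)
              with zero True show ?thesis by auto
            next
              case False
              then have "\<not> r' + b \<le> j" using \<open>r' \<le> j\<close> by (auto simp: t_def)
              then show ?thesis using False by (simp only: IH[OF x] if_False mult_0_right)
            qed
          qed
          then have "(\<Sum>b\<le>s x - 1. ?g b) = (\<Sum>b\<le>s x - 1. if b \<le> t then ?h b else 0)"
            by (intro sum.cong) auto
          also have "\<dots> = (\<Sum>b\<le>t. ?h b)"
            by (rule sum.mono_neutral_cong) (auto simp: binomial_eq_0)
          finally show ?thesis by (simp only: sum_distrib_left)
        qed
        have "?S = fact i * 2 ^ (M - t) *
          (\<Sum>x\<in>A. \<Sum>b\<le>t. (r' + b) * (s x - 1 choose b) * (M - (s x - 1) choose (t - b)))"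
          unfolding * sum_distrib_left[of _ _ A] using inner by (intro sum.cong) auto
        \<comment> \<open>Here the individual sizes cancel. The part with \<open>r'\<close> is a
          Vandermonde sum for each of the \<open>Suc j\<close> choices of \<open>x\<close>; the part
          with \<open>b\<close> adds up to \<open>t * (M choose t)\<close>, because the
          \<open>s x - 1\<close> sum to \<open>M\<close>. Finally
          \<open>r' * Suc j + t = j * r\<close>.\<close>
        also have "(\<Sum>x\<in>A. \<Sum>b\<le>t. (r' + b) * (s x - 1 choose b) * (M - (s x - 1) choose (t - b))) =
            j * r * (M choose t)"
        proof -
          have sM: "s x - 1 \<le> M" if "x \<in> A" for x
          proof -
            have "j \<le> sum s (A - {x})"
              using sum_mono[of "A - {x}" "\<lambda>_. 1" s] Suc.prems(3) less(1)[OF that] by simp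
            then show ?thesis using less[OF that] Suc.hyps(2) unfolding M_def by simp
          qed
          have sumM: "(\<Sum>x\<in>A. s x - 1) = M"
            unfolding M_def using Suc.prems(3) by (subst sum_subtractf_nat) auto
          define W where "W = (\<Sum>x\<in>A. \<Sum>b\<le>t. b * (s x - 1 choose b) * (M - (s x - 1) choose (t - b)))"
          have "W * M = (\<Sum>x\<in>A. (s x - 1) * t * (M choose t))"
            unfolding W_def sum_distrib_right[of _ A]
          proof (rule sum.cong)
            fix x assume "x \<in> A"
            from vandermonde_weighted[where t = t and m = "s x - 1" and n = "M - (s x - 1)"] sM[OF this]
            show "(\<Sum>b\<le>t. b * (s x - 1 choose b) * (M - (s x - 1) choose (t - b))) * M =
                (s x - 1) * t * (M choose t)" by (simp only: le_add_diff_inverse)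
          qed simp
          also have "\<dots> = M * t * (M choose t)"
            unfolding sum_distrib_right[symmetric] sumM ..
          finally have W: "W = t * (M choose t)"
          \<comment> \<open>The factor \<open>M\<close> cancels only if it is nonzero. If
            \<open>M = 0\<close>, every \<open>s x - 1\<close> is zero and both sides
            vanish.\<close>
          proof (cases "M = 0")
            case True
            then have "W = 0"
              using sM unfolding W_def by (auto simp: sum_eq_0_iff gr0_conv_Suc)
            then show ?thesis using True by (cases t) auto
          qed simp
          have "(\<Sum>x\<in>A. \<Sum>b\<le>t. (r' + b) * (s x - 1 choose b) * (M - (s x - 1) choose (t - b))) =
             r' * (\<Sum>x\<in>A. \<Sum>b\<le>t. (s x - 1 choose b) * (M - (s x - 1) choose (t - b))) + W"
            unfolding W_def by (simp add: algebra_simps sum.distrib sum_distrib_left)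
          also have "(\<Sum>x\<in>A. \<Sum>b\<le>t. (s x - 1 choose b) * (M - (s x - 1) choose (t - b))) = Suc j * (M choose t)"
            using sM by (simp add: vandermonde Suc.hyps(2))
          also have "r' * (Suc j * (M choose t)) + W = (r' * Suc j + t) * (M choose t)"
            using W by (simp add: algebra_simps)
          also have "r' * Suc j + t = j * r"
            using True by (simp add: Suc t_def)
          finally show ?thesis .
        qed
        finally have total: "?S = fact i * 2 ^ (M - t) * (j * r * (M choose t))" .
        have cA: "r \<le> card A" "card A - r = t" "card A - 1 = Suc i"
          using True Suc.hyps(2) Suc j by (simp_all add: t_def)
        show ?thesis
          unfolding total Let_def M_def[symmetric] cA(2,3) if_P[OF cA(1)]
          by (simp only: j fact_Suc of_nat_id mult_ac)
      qed
    qed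
  qed
qed auto

section \<open>Partitions into invariant blocks\<close>

lemma partition_on_unique:
  "partition_on A P \<Longrightarrow> B \<in> P \<Longrightarrow> C \<in> P \<Longrightarrow> x \<in> B \<Longrightarrow> x \<in> C \<Longrightarrow> B = C"
  by (auto simp: partition_on_def disjoint_def)

lemma partition_on_remove:
  assumes "partition_on A P" "B \<in> P"
  shows "partition_on (A - B) (P - {B})" "B \<subseteq> A" "B \<noteq> {}"
proof -
  have "disjnt B (\<Union>(P - {B}))"
    using assms by (auto simp: partition_on_def disjoint_def disjnt_def)
  from partition_on_insert[OF this, of A] assms
  show "partition_on (A - B) (P - {B})" "B \<subseteq> A" "B \<noteq> {}"
    by (simp_all add: insert_absorb)
qed

lemma partition_on_add:
  assumes "partition_on (A - B) P" "B \<subseteq> A" "B \<noteq> {}"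
  shows "partition_on A (insert B P)" "B \<notin> P"
proof -
  have "disjnt B (\<Union>P)" using partition_onD1[OF assms(1)] by (auto simp: disjnt_def)
  from partition_on_insert[OF this, of A] assms show "partition_on A (insert B P)" by simp
  show "B \<notin> P" using \<open>disjnt B (\<Union>P)\<close> \<open>B \<noteq> {}\<close> by (auto simp: disjnt_def)
qed

text \<open>The Stirling recurrence is matched by the position of the new element \<open>x\<close>:
  either \<open>{x}\<close> is a block (\<open>Q1\<close>), or \<open>x\<close> has been put into
  one of the blocks of a partition of \<open>A\<close> (\<open>Q2\<close>).\<close>

lemma card_partition_on:
  assumes "finite A"
  shows "card {P. partition_on A P \<and> card P = j} = Stirling (card A) j"
  using assms
proof (induction A arbitrary: j rule: finite_induct)
  case empty
  have *: "{P. partition_on {} P \<and> card P = j} = (if j = 0 then {{}} else {})"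
    by (auto simp: partition_on_empty)
  show ?case unfolding * by (cases j) simp_all
next
  case (insert x A)
  define \<P> where "\<P> i = {P. partition_on A P \<and> card P = i}" for i
  have fin\<P>: "finite (\<P> i)" for i
    using finitely_many_partition_on[OF insert.hyps(1)] by (simp add: \<P>_def)
  have finP: "finite P" if "partition_on (insert x A) P \<or> partition_on A P" for P
    using that finite_elements insert.hyps(1) by blast
  show ?case
  proof (cases j)
    case 0
    have *: "{P. partition_on (insert x A) P \<and> card P = 0} = {}"
    proof -
      have "card P \<noteq> 0" if P: "partition_on (insert x A) P" for P
      proof -
        have "P \<noteq> {}" using partition_onD1[OF P] by auto
        then show ?thesis using finP[of P] P by simp
      qed
      then show ?thesis by blast
    qed
    show ?thesis unfolding 0 * using insert.hyps by simp
  next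
    case (Suc i)
    define Q1 where "Q1 = {P. partition_on (insert x A) P \<and> card P = Suc i \<and> {x} \<in> P}"
    define Q2 where "Q2 = {P. partition_on (insert x A) P \<and> card P = Suc i \<and> {x} \<notin> P}"
    have "bij_betw (insert {x}) (\<P> i) Q1"
    proof (rule bij_betw_byWitness[where f' = "\<lambda>P. P - {{x}}"])
      have diff: "insert x A - {x} = A" using insert.hyps(2) by auto
      have *: "partition_on (insert x A) (insert {x} P)" "{x} \<notin> P" if "partition_on A P" for P
        using partition_on_add[of "insert x A" "{x}" P] that by (simp_all add: diff)
      show "insert {x} ` \<P> i \<subseteq> Q1" "\<forall>P\<in>\<P> i. insert {x} P - {{x}} = P"
        using * finP by (auto simp: \<P>_def Q1_def)
      show "(\<lambda>P. P - {{x}}) ` Q1 \<subseteq> \<P> i" "\<forall>P\<in>Q1. insert {x} (P - {{x}}) = P"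
        using partition_on_remove(1)[of "insert x A" _ "{x}"] diff
        by (auto simp: \<P>_def Q1_def)
    qed
    then have 1: "card Q1 = Stirling (card A) i"
      using insert.IH[of i] by (simp add: bij_betw_same_card \<P>_def)
    \<comment> \<open>The block of \<open>P\<close> containing \<open>x\<close>, needed to undo the
      insertion of \<open>x\<close>; the union avoids a choice operator.\<close>
    define blk where "blk P = \<Union>{B \<in> P. x \<in> B}" for P
    have blk: "blk P = B" if "partition_on (insert x A) P" "B \<in> P" "x \<in> B" for P B
    proof -
      have "{B \<in> P. x \<in> B} = {B}"
        using that by (auto dest: partition_on_unique)
      then show ?thesis by (simp add: blk_def)
    qed
    have "bij_betw (\<lambda>(P, B). insert (insert x B) (P - {B})) (Sigma (\<P> (Suc i)) (\<lambda>P. P)) Q2"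
    proof (rule bij_betw_byWitness[where f' = "\<lambda>P. (insert (blk P - {x}) (P - {blk P}), blk P - {x})"])
      have *: "partition_on (insert x A) (insert (insert x B) (P - {B}))" "insert x B \<notin> P - {B}"
          "{x} \<notin> insert (insert x B) (P - {B})" "x \<notin> B"
          "blk (insert (insert x B) (P - {B})) = insert x B"
        if "partition_on A P" "B \<in> P" for P B
      proof -
        note r = partition_on_remove[OF that]
        show "x \<notin> B" using r(2) insert.hyps(2) by auto
        have "insert x A - insert x B = A - B" using insert.hyps(2) by auto
        with r show p: "partition_on (insert x A) (insert (insert x B) (P - {B}))" "insert x B \<notin> P - {B}"
          using partition_on_add[of "insert x A" "insert x B" "P - {B}"] by auto
        show "{x} \<notin> insert (insert x B) (P - {B})"
          using r \<open>x \<notin> B\<close> that insert.hyps(2) by (auto simp: partition_on_def)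
        show "blk (insert (insert x B) (P - {B})) = insert x B"
          using blk[OF p(1)] by simp
      qed
      show "(\<lambda>(P, B). insert (insert x B) (P - {B})) ` Sigma (\<P> (Suc i)) (\<lambda>P. P) \<subseteq> Q2"
      proof safe
        fix P B assume "P \<in> \<P> (Suc i)" "B \<in> P"
        then have p: "partition_on A P" "B \<in> P" "card P = Suc i" by (auto simp: \<P>_def)
        note *[OF p(1,2)]
        moreover have "card (insert (insert x B) (P - {B})) = Suc i"
          using *(2)[OF p(1,2)] p finP[of P] by simp
        ultimately show "insert (insert x B) (P - {B}) \<in> Q2" by (simp add: Q2_def)
      qed
      have inv: "(insert (blk (insert (insert x B) (P - {B})) - {x})
            (insert (insert x B) (P - {B}) - {blk (insert (insert x B) (P - {B}))}),
          blk (insert (insert x B) (P - {B})) - {x}) = (P, B)"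
        if "P \<in> \<P> (Suc i)" "B \<in> P" for P B
      proof -
        from that have p: "partition_on A P" "B \<in> P" by (auto simp: \<P>_def)
        note q = *[OF p]
        have "insert x B - {x} = B" using q(4) by auto
        moreover have "insert B (insert (insert x B) (P - {B}) - {insert x B}) = P" using q(2) p by auto
        ultimately show ?thesis by (simp only: q(5))
      qed
      show "\<forall>p\<in>Sigma (\<P> (Suc i)) (\<lambda>P. P). (\<lambda>P. (insert (blk P - {x}) (P - {blk P}), blk P - {x}))
           ((\<lambda>(P, B). insert (insert x B) (P - {B})) p) = p"
        by (rule ballI, erule SigmaE) (simp only: split_conv inv)
      have **: "blk P \<in> P" "x \<in> blk P" "partition_on A (insert (blk P - {x}) (P - {blk P}))"
          "blk P - {x} \<notin> P - {blk P}"
        if p: "partition_on (insert x A) P" "{x} \<notin> P" for P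
      proof -
        obtain B where B: "B \<in> P" "x \<in> B" using partition_onD1[OF p(1)] by auto
        note b = blk[OF p(1) B]
        show "blk P \<in> P" "x \<in> blk P" using b B by simp_all
        note r = partition_on_remove[OF p(1) B(1)]
        have "B - {x} \<noteq> {}" using B p(2) by (metis Diff_eq_empty_iff insert_absorb subset_singletonD empty_iff)
        moreover have "insert x A - B = A - (B - {x})" "B - {x} \<subseteq> A" using B r insert.hyps(2) by auto
        ultimately show "partition_on A (insert (blk P - {x}) (P - {blk P}))" "blk P - {x} \<notin> P - {blk P}"
          using partition_on_add[of A "B - {x}" "P - {B}"] r by (auto simp: b)
      qed
      show "\<forall>P\<in>Q2. (\<lambda>(P, B). insert (insert x B) (P - {B})) (insert (blk P - {x}) (P - {blk P}), blk P - {x}) = P"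
      proof
        fix P assume "P \<in> Q2"
        then have p: "partition_on (insert x A) P" "{x} \<notin> P" by (auto simp: Q2_def)
        show "(\<lambda>(P, B). insert (insert x B) (P - {B})) (insert (blk P - {x}) (P - {blk P}), blk P - {x}) = P"
          using **[OF p] by (simp add: insert_absorb)
      qed
      show "(\<lambda>P. (insert (blk P - {x}) (P - {blk P}), blk P - {x})) ` Q2 \<subseteq> Sigma (\<P> (Suc i)) (\<lambda>P. P)"
      proof (rule image_subsetI)
        fix P assume "P \<in> Q2"
        then have p: "partition_on (insert x A) P" "{x} \<notin> P" "card P = Suc i" by (auto simp: Q2_def)
        then show "(insert (blk P - {x}) (P - {blk P}), blk P - {x}) \<in> Sigma (\<P> (Suc i)) (\<lambda>P. P)"
          using **[OF p(1,2)] finP by (simp add: \<P>_def card_insert_disjoint)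
      qed
    qed
    then have "card Q2 = card (Sigma (\<P> (Suc i)) (\<lambda>P. P))"
      by (simp add: bij_betw_same_card)
    also have "\<dots> = (\<Sum>P\<in>\<P> (Suc i). card P)"
      using fin\<P> finP by (intro card_SigmaI) (auto simp: \<P>_def)
    also have "\<dots> = Suc i * Stirling (card A) (Suc i)"
      using insert.IH[of "Suc i"] by (simp add: \<P>_def)
    finally have 2: "card Q2 = \<dots>" .
    have "finite Q1" "finite Q2" "Q1 \<inter> Q2 = {}"
      using finitely_many_partition_on[of "insert x A"] insert.hyps(1)
      by (auto simp: Q1_def Q2_def)
    moreover have "{P. partition_on (insert x A) P \<and> card P = j} = Q1 \<union> Q2"
      by (auto simp: Suc Q1_def Q2_def)
    ultimately show ?thesis
      using 1 2 insert.hyps Suc by (simp add: card_Un_disjoint)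
  qed
qed

lemma sum_partition_on:
  assumes "finite A"
  shows "(\<Sum>P | partition_on A P. f (card P)) = (\<Sum>j\<le>card A. Stirling (card A) j * f j)"
proof -
  have "card P \<le> card A" if P: "partition_on A P" for P
  proof (rule card_le_if_inj_on_rel[where r = "\<lambda>B x. x \<in> B"])
    show "\<exists>x. x \<in> A \<and> x \<in> B" if "B \<in> P" for B
      using partition_on_remove[OF P that] by auto
    show "B = C" if "B \<in> P" "C \<in> P" "x \<in> A" "x \<in> B" "x \<in> C" for B C x
      using that partition_onD2[OF P] by (auto simp: disjoint_def)
  qed (fact assms)
  then have "(\<Sum>P | partition_on A P. f (card P)) =
     (\<Sum>j\<le>card A. \<Sum>P | P \<in> {P. partition_on A P} \<and> card P = j. f (card P))"
    using assms by (intro sum.group[symmetric]) (auto simp: finitely_many_partition_on)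
  also have "\<dots> = (\<Sum>j\<le>card A. Stirling (card A) j * f j)"
    using card_partition_on[OF assms] by simp
  finally show ?thesis .
qed

text \<open>A union of members of \<open>\<O>\<close> determines which members it contains, since
  these are nonempty and disjoint. Hence coarsenings of \<open>\<O>\<close> correspond to partitions
  of the set \<open>\<O>\<close> itself; the inverse map \<open>h\<close> collects the members
  inside a block.\<close>

lemma bij_betw_partition_on_Union:
  assumes "partition_on X \<O>"
  shows "bij_betw ((`) Union) {Q. partition_on \<O> Q} {P. partition_on X P \<and> (\<forall>B\<in>P. \<exists>C\<subseteq>\<O>. B = \<Union>C)}"
    and "partition_on \<O> Q \<Longrightarrow> card (Union ` Q) = card Q"
proof -
  define h where "h B = {c \<in> \<O>. c \<subseteq> B}" for B
  have h: "h (\<Union>C) = C" if "C \<subseteq> \<O>" for C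
  proof -
    have "c \<in> C" if c: "c \<in> \<O>" "c \<subseteq> \<Union>C" for c
    proof -
      obtain z where "z \<in> c" using partition_on_remove(3)[OF assms c(1)] by blast
      with c obtain d where "d \<in> C" "z \<in> d" by auto
      with partition_on_unique[OF assms c(1), of d z] \<open>z \<in> c\<close> \<open>C \<subseteq> \<O>\<close> show ?thesis
        by auto
    qed
    then show ?thesis using that by (auto simp: h_def)
  qed
  have sub: "C \<subseteq> \<O>" if "partition_on \<O> Q" "C \<in> Q" for Q C
    using that by (auto simp: partition_on_def)
  have hU: "h ` Union ` Q = Q" if "partition_on \<O> Q" for Q
    using h sub[OF that] by (force simp: image_image)
  show "card (Union ` Q) = card Q" if "partition_on \<O> Q" for Q
    by (rule card_image, rule inj_on_inverseI[where g = h]) (use h sub[OF that] in auto)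
  show "bij_betw ((`) Union) {Q. partition_on \<O> Q} {P. partition_on X P \<and> (\<forall>B\<in>P. \<exists>C\<subseteq>\<O>. B = \<Union>C)}"
  proof (rule bij_betw_byWitness[where f' = "(`) h"])
    show "\<forall>Q\<in>{Q. partition_on \<O> Q}. h ` Union ` Q = Q" using hU by auto
    have Uh: "\<Union>(h B) = B" if "\<exists>C\<subseteq>\<O>. B = \<Union>C" for B using that h by auto
    then show "\<forall>P\<in>{P. partition_on X P \<and> (\<forall>B\<in>P. \<exists>C\<subseteq>\<O>. B = \<Union>C)}. Union ` h ` P = P"
      by (force simp: image_image)
    show "(`) Union ` {Q. partition_on \<O> Q} \<subseteq> {P. partition_on X P \<and> (\<forall>B\<in>P. \<exists>C\<subseteq>\<O>. B = \<Union>C)}"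
    proof safe
      fix Q assume Q: "partition_on \<O> Q"
      show "\<exists>C'\<subseteq>\<O>. \<Union>C = \<Union>C'" if "C \<in> Q" for C using sub[OF Q that] by blast
      show "partition_on X (Union ` Q)"
      proof (rule partition_onI)
        show "\<Union>(Union ` Q) = X"
          using partition_onD1[OF Q] partition_onD1[OF assms] by auto
        show "{} \<notin> Union ` Q"
        proof
          assume "{} \<in> Union ` Q"
          then obtain C where C: "C \<in> Q" "\<Union>C = {}" by auto
          then obtain c where "c \<in> C" using partition_on_remove(3)[OF Q C(1)] by blast
          then have "c \<noteq> {}" using partition_on_remove(3)[OF assms, of c] sub[OF Q C(1)] by blast
          with \<open>c \<in> C\<close> C(2) show False by blast
        qed
        fix p q assume "p \<in> Union ` Q" "q \<in> Union ` Q" "p \<noteq> q"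
        then obtain C D where CD: "C \<in> Q" "D \<in> Q" "C \<noteq> D" "p = \<Union>C" "q = \<Union>D" by auto
        have "C = D" if "x \<in> p" "x \<in> q" for x
        proof -
          from that obtain c d where cd: "c \<in> C" "x \<in> c" "d \<in> D" "x \<in> d" by (auto simp: CD)
          then have "c = d" using partition_on_unique[OF assms, of c d x] sub[OF Q] CD(1,2) by auto
          then show ?thesis using partition_on_unique[OF Q CD(1,2)] cd by auto
        qed
        then show "disjnt p q" using CD(3) by (auto simp: disjnt_iff)
      qed
    qed
    show "(`) h ` {P. partition_on X P \<and> (\<forall>B\<in>P. \<exists>C\<subseteq>\<O>. B = \<Union>C)} \<subseteq> {Q. partition_on \<O> Q}"
    proof safe
      fix P assume P: "partition_on X P" "\<forall>B\<in>P. \<exists>C\<subseteq>\<O>. B = \<Union>C"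
      show "partition_on \<O> (h ` P)"
      proof (rule partition_onI)
        have "\<exists>B\<in>P. c \<subseteq> B" if c: "c \<in> \<O>" for c
        proof -
          obtain z where z: "z \<in> c" "z \<in> X" using partition_on_remove(2,3)[OF assms c] by blast
          then obtain B where B: "B \<in> P" "z \<in> B" using partition_onD1[OF P(1)] by auto
          then obtain C d where "C \<subseteq> \<O>" "B = \<Union>C" "d \<in> C" "z \<in> d" using P(2) by (metis UnionE)
          moreover from this have "d = c" using partition_on_unique[OF assms, of d c z] z c by auto
          ultimately show ?thesis using B by auto
        qed
        then show "\<Union>(h ` P) = \<O>" by (auto simp: h_def)
        show "{} \<notin> h ` P"
        proof
          assume "{} \<in> h ` P"
          then obtain B where B: "B \<in> P" "h B = {}" by auto
          with P(2) Uh[of B] have "B = {}" by simp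
          with B partition_onD3[OF P(1)] show False by simp
        qed
        fix p q assume "p \<in> h ` P" "q \<in> h ` P" "p \<noteq> q"
        then obtain B D where BD: "B \<in> P" "D \<in> P" "B \<noteq> D" "p = h B" "q = h D" by auto
        then have "B \<inter> D = {}" using P(1) by (auto simp: partition_on_def disjoint_def)
        have False if "c \<in> p" "c \<in> q" for c
        proof -
          from that have "c \<in> \<O>" "c \<subseteq> B \<inter> D" by (auto simp: BD h_def)
          with \<open>B \<inter> D = {}\<close> partition_on_remove(3)[OF assms, of c] show False by auto
        qed
        then show "disjnt p q" unfolding disjnt_iff by blast
      qed
    qed
  qed
qed

section \<open>Invariant blocks as unions of orbits\<close>

lemma partition_on_orbits:
  assumes "\<sigma> permutes A" "finite A"
  shows "partition_on A (orbit \<sigma> ` A)"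
proof (rule partition_onI)
  have perm: "permutation \<sigma>" using assms by (auto simp: permutation_permutes)
  show "\<Union>(orbit \<sigma> ` A) = A"
    using permutes_orbit_subset[OF assms(1)] permutation_self_in_orbit[OF perm] by blast
  show "{} \<notin> orbit \<sigma> ` A" using orbit_nonempty by (metis imageE)
  fix p q assume "p \<in> orbit \<sigma> ` A" "q \<in> orbit \<sigma> ` A" "p \<noteq> q"
  then show "disjnt p q"
    using orbit_cyclic_eq3[OF cyclic_on_orbit'[OF perm]] unfolding disjnt_iff by blast
qed

text \<open>An invariant set contains the orbit of each of its points. Conversely, a union of orbits
  is mapped into itself, and an injective self-map of a finite set is onto.\<close>

lemma image_eq_iff_union_of_orbits:
  assumes "\<sigma> permutes A" "finite A" "B \<subseteq> A"
  shows "\<sigma> ` B = B \<longleftrightarrow> (\<exists>C\<subseteq>orbit \<sigma> ` A. B = \<Union>C)"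
proof
  have perm: "permutation \<sigma>" using assms by (auto simp: permutation_permutes)
  assume *: "\<sigma> ` B = B"
  have "y \<in> B" if "y \<in> orbit \<sigma> x" "x \<in> B" for x y
    using that by induction (use * in auto)
  then have "B = \<Union>(orbit \<sigma> ` B)" using permutation_self_in_orbit[OF perm] by auto
  then show "\<exists>C\<subseteq>orbit \<sigma> ` A. B = \<Union>C"
    using image_mono[OF \<open>B \<subseteq> A\<close>, of "orbit \<sigma>"] by (intro exI[of _ "orbit \<sigma> ` B"] conjI)
next
  assume "\<exists>C\<subseteq>orbit \<sigma> ` A. B = \<Union>C"
  then obtain C where C: "C \<subseteq> orbit \<sigma> ` A" "B = \<Union>C" by auto
  have "\<sigma> y \<in> B" if "y \<in> B" for y
  proof -
    from that C obtain x where "orbit \<sigma> x \<in> C" "y \<in> orbit \<sigma> x" by auto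
    then show ?thesis using C(2) orbit.step[of y \<sigma> x] by blast
  qed
  moreover have "finite B" using assms(2,3) finite_subset by auto
  ultimately show "\<sigma> ` B = B"
    using endo_inj_surj[of B \<sigma>] permutes_inj_on[OF assms(1), of B] by auto
qed

text \<open>Invariant partitions are the coarsenings of the partition into orbits, hence the
  partitions of a set of \<open>k\<close> cycles with the same number of blocks.\<close>

lemma sum_invariant_partition_on:
  assumes "\<sigma> permutes A" "finite A" "card (orbit \<sigma> ` A) = k"
  shows "(\<Sum>P | partition_on A P \<and> (\<forall>B\<in>P. \<sigma> ` B = B). f (card P)) = (\<Sum>j\<le>k. Stirling k j * f j)"
proof -
  note \<O> = partition_on_orbits[OF assms(1,2)]
  have "{P. partition_on A P \<and> (\<forall>B\<in>P. \<sigma> ` B = B)} =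
     {P. partition_on A P \<and> (\<forall>B\<in>P. \<exists>C\<subseteq>orbit \<sigma> ` A. B = \<Union>C)}"
  proof -
    have "(\<sigma> ` B = B) = (\<exists>C\<subseteq>orbit \<sigma> ` A. B = \<Union>C)" if "partition_on A P" "B \<in> P" for P B
      by (rule image_eq_iff_union_of_orbits[OF assms(1,2) partition_on_remove(2)[OF that]])
    then show ?thesis by (intro Collect_cong conj_cong ball_cong refl)
  qed
  then have "(\<Sum>P | partition_on A P \<and> (\<forall>B\<in>P. \<sigma> ` B = B). f (card P)) =
      (\<Sum>Q | partition_on (orbit \<sigma> ` A) Q. f (card (Union ` Q)))"
    using sum.reindex_bij_betw[OF bij_betw_partition_on_Union(1)[OF \<O>], of "\<lambda>P. f (card P)"] by simp
  also have "\<dots> = (\<Sum>Q | partition_on (orbit \<sigma> ` A) Q. f (card Q))"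
    using bij_betw_partition_on_Union(2)[OF \<O>] by simp
  also have "\<dots> = (\<Sum>j\<le>k. Stirling k j * f j)"
    using sum_partition_on[of "orbit \<sigma> ` A" f] assms by simp
  finally show ?thesis .
qed

section \<open>Bernardi trees as shapes with ordered partitions\<close>

text \<open>Defined on lists of nodes so that it also applies to the concatenated nodes of a
  forest.\<close>

definition block_lengths :: "'a tree list \<Rightarrow> nat list" where
  "block_lengths vs = map length (cut_after terminal vs)"

text \<open>The effect of prepending a nonterminal node: it joins the first block, or forms a block
  of its own if nothing follows.\<close>

definition cons_block :: "nat list \<Rightarrow> nat list" where
  "cons_block as = (case as of [] \<Rightarrow> [1] | a # as \<Rightarrow> Suc a # as)"

lemma block_lengths_simps [simp]:
  "block_lengths [] = []"
  "block_lengths (v # vs) = (if terminal v then 1 # block_lengths vs else cons_block (block_lengths vs))"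
  by (auto simp: block_lengths_def cons_block_def split: list.split)

lemma cons_block_neq [simp]: "cons_block as \<noteq> []" "cons_block as \<noteq> 0 # bs" "0 # bs \<noteq> cons_block as"
  by (auto simp: cons_block_def split: list.split)

lemma block_lengths_eq_Nil [simp]: "block_lengths vs = [] \<longleftrightarrow> vs = []"
  by (cases vs) auto

lemma block_lengths_pos: "block_lengths vs \<noteq> 0 # as"
  by (cases vs) auto

lemma cons_block_eq_1: "cons_block (block_lengths vs) = Suc 0 # as \<longleftrightarrow> vs = [] \<and> as = []"
  using block_lengths_pos[of vs] by (cases "block_lengths vs") (auto simp: cons_block_def)

lemma cons_block_eq_Suc_Suc: "cons_block as = Suc (Suc a) # bs \<longleftrightarrow> as = Suc a # bs"
  by (auto simp: cons_block_def split: list.split)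

lemma nodes_eq_Nil [simp]: "nodes T = [] \<longleftrightarrow> T = \<langle>\<rangle>"
  by (cases T) auto

definition forests :: "nat list \<Rightarrow> nat \<Rightarrow> unit tree list set" where
  "forests as r = {ts. length ts = r \<and> \<langle>\<rangle> \<notin> set ts \<and> block_lengths (concat (map nodes ts)) = as}"

text \<open>Deleting the first root leaves its subtrees at the front of the forest, the right one
  first as in \<open>nodes\<close>. A first factor of length one forces a terminal root; otherwise
  the three images stand for a left child only, a right child only, and two children.\<close>

lemma forests_rec:
  "forests (Suc 0 # as) (Suc r) = (#) \<langle>\<langle>\<rangle>, (), \<langle>\<rangle>\<rangle> ` forests as r"
  "forests (Suc (Suc a) # as) (Suc r) =
     (\<lambda>ts. \<langle>hd ts, (), \<langle>\<rangle>\<rangle> # tl ts) ` forests (Suc a # as) (Suc r) \<union>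
     (\<lambda>ts. \<langle>\<langle>\<rangle>, (), hd ts\<rangle> # tl ts) ` forests (Suc a # as) (Suc r) \<union>
     (\<lambda>ts. \<langle>hd (tl ts), (), hd ts\<rangle> # tl (tl ts)) ` forests (Suc a # as) (Suc (Suc r))"
  (is "_ = ?A \<union> ?B \<union> ?C")
proof -
  show "forests (Suc 0 # as) (Suc r) = (#) \<langle>\<langle>\<rangle>, (), \<langle>\<rangle>\<rangle> ` forests as r"
  proof (intro equalityI subsetI)
    fix ts assume "ts \<in> forests (Suc 0 # as) (Suc r)"
    then obtain l r' ts' where ts: "ts = \<langle>l, (), r'\<rangle> # ts'" "length ts' = r" "\<langle>\<rangle> \<notin> set ts'"
      "block_lengths (concat (map nodes ts)) = Suc 0 # as"
      by (cases ts; cases "hd ts") (auto simp: forests_def)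
    then show "ts \<in> (#) \<langle>\<langle>\<rangle>, (), \<langle>\<rangle>\<rangle> ` forests as r"
      by (auto simp: terminal_def forests_def cons_block_eq_1 split: if_splits)
  qed (auto simp: forests_def terminal_def)
  show "forests (Suc (Suc a) # as) (Suc r) = ?A \<union> ?B \<union> ?C"
  proof (intro equalityI subsetI)
    fix ts assume "ts \<in> forests (Suc (Suc a) # as) (Suc r)"
    then obtain l r' ts' where ts: "ts = \<langle>l, (), r'\<rangle> # ts'" "length ts' = r" "\<langle>\<rangle> \<notin> set ts'"
      "block_lengths (concat (map nodes ts)) = Suc (Suc a) # as"
      by (cases ts; cases "hd ts") (auto simp: forests_def)
    then have nt: "l \<noteq> \<langle>\<rangle> \<or> r' \<noteq> \<langle>\<rangle>"
      and b: "block_lengths (nodes r' @ nodes l @ concat (map nodes ts')) = Suc a # as"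
      by (auto simp: terminal_def cons_block_eq_Suc_Suc split: if_splits)
    consider "r' = \<langle>\<rangle>" "l \<noteq> \<langle>\<rangle>" | "l = \<langle>\<rangle>" "r' \<noteq> \<langle>\<rangle>" | "l \<noteq> \<langle>\<rangle>" "r' \<noteq> \<langle>\<rangle>" using nt by auto
    then show "ts \<in> ?A \<union> ?B \<union> ?C"
    proof cases
      case 1
      then have "ts \<in> ?A" using ts b by (intro image_eqI[of _ _ "l # ts'"]) (auto simp: forests_def)
      then show ?thesis by blast
    next
      case 2
      then have "ts \<in> ?B" using ts b by (intro image_eqI[of _ _ "r' # ts'"]) (auto simp: forests_def)
      then show ?thesis by blast
    next
      case 3
      then have "ts \<in> ?C" using ts b by (intro image_eqI[of _ _ "r' # l # ts'"]) (auto simp: forests_def)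
      then show ?thesis by blast
    qed
  next
    have "?A \<subseteq> forests (Suc (Suc a) # as) (Suc r)" "?B \<subseteq> forests (Suc (Suc a) # as) (Suc r)"
      by (intro image_subsetI; auto simp: forests_def length_Suc_conv terminal_def cons_block_eq_Suc_Suc)+
    moreover have "?C \<subseteq> forests (Suc (Suc a) # as) (Suc r)"
      by (intro image_subsetI; auto simp: forests_def length_Suc_conv terminal_def cons_block_eq_Suc_Suc)
    ultimately show "ts \<in> forests (Suc (Suc a) # as) (Suc r)" if "ts \<in> ?A \<union> ?B \<union> ?C" for ts
      using that by blast
  qed
qed

lemma card_forests: "finite (forests as r) \<and> card (forests as r) = forest_count as r"
proof (induction as r rule: forest_count.induct)
  case (1 r)
  have "forests [] r = (if r = 0 then {[]} else {})"
  proof -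
    have "ts = []" if "ts \<in> forests [] r" for ts
      using that by (cases ts) (auto simp: forests_def)
    then show ?thesis by (auto simp: forests_def)
  qed
  then show ?case by simp
next
  case (2 a as)
  then show ?case by (simp add: forests_def)
next
  case (3 as r)
  then show ?case by (simp add: forests_def block_lengths_pos)
next
  case (4 as r)
  then show ?case by (simp add: forests_rec card_image)
next
  case (5 a as r)
  let ?F = "forests (Suc a # as) (Suc r)" and ?G = "forests (Suc a # as) (Suc (Suc r))"
  let ?fA = "\<lambda>ts. \<langle>hd ts, (), \<langle>\<rangle>\<rangle> # tl ts" and ?fB = "\<lambda>ts. \<langle>\<langle>\<rangle>, (), hd ts\<rangle> # tl ts"
  let ?fC = "\<lambda>ts. \<langle>hd (tl ts), (), hd ts\<rangle> # tl (tl ts) :: unit tree list"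
  have c: "hd ts \<noteq> \<langle>\<rangle>" "ts = hd ts # tl ts" if "ts \<in> ?F" for ts
    using that by (cases ts; auto simp: forests_def)+
  have d: "hd ts \<noteq> \<langle>\<rangle>" "hd (tl ts) \<noteq> \<langle>\<rangle>" "ts = hd ts # hd (tl ts) # tl (tl ts)" if "ts \<in> ?G" for ts
    using that by (cases ts; cases "tl ts"; auto simp: forests_def)+
  have "inj_on ?fA ?F" by (rule inj_onI) (metis c(2) list.inject tree.inject)
  moreover have "inj_on ?fB ?F" by (rule inj_onI) (metis c(2) list.inject tree.inject)
  moreover have "inj_on ?fC ?G" by (rule inj_onI) (metis d(3) list.inject tree.inject)
  moreover have "?fA ` ?F \<inter> ?fB ` ?F = {}" "(?fA ` ?F \<union> ?fB ` ?F) \<inter> ?fC ` ?G = {}"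
    using c(1) d(1,2) by auto
  ultimately show ?case
    using 5 by (simp add: forests_rec card_Un_disjoint card_image)
qed

section \<open>The Bernardi condition in terms of factors\<close>

lemma hd_nodes [simp]: "T \<noteq> \<langle>\<rangle> \<Longrightarrow> hd (nodes T) = T"
  by (cases T) auto

lemma cut_after_map: "cut_after P (map g xs) = map (map g) (cut_after (P \<circ> g) xs)"
  by (induction xs) (auto split: list.split)

lemma Nil_notin_cut_after [simp]: "[] \<notin> set (cut_after P xs)"
  by (induction xs) (auto split: list.split)

lemma hd_hd_cut_after [simp]: "xs \<noteq> [] \<Longrightarrow> hd (hd (cut_after P xs)) = hd xs"
  by (cases xs) (auto split: list.split)

lemma cut_after_eq_Nil [simp]: "cut_after P xs = [] \<longleftrightarrow> xs = []"
  by (cases xs) (auto split: list.split)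

definition decreasing_blocks :: "nat tree list \<Rightarrow> bool" where
  "decreasing_blocks vs \<longleftrightarrow> (\<forall>w\<in>set (cut_after terminal vs). sorted_wrt (>) (map value w))"

lemma decreasing_blocks_simps [simp]:
  "decreasing_blocks []"
  "decreasing_blocks (v # vs) \<longleftrightarrow>
     decreasing_blocks vs \<and> (\<not> terminal v \<longrightarrow> vs \<noteq> [] \<longrightarrow> value (hd vs) < value v)"
proof -
  show "decreasing_blocks []" by (simp add: decreasing_blocks_def)
  show "decreasing_blocks (v # vs) \<longleftrightarrow>
     decreasing_blocks vs \<and> (\<not> terminal v \<longrightarrow> vs \<noteq> [] \<longrightarrow> value (hd vs) < value v)"
  proof (cases "terminal v \<or> vs = []")
    case False
    then obtain w ws where ws: "cut_after terminal vs = w # ws"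
      by (cases "cut_after terminal vs") auto
    then obtain u us where "w = u # us"
      using Nil_notin_cut_after[of terminal vs] by (cases w) auto
    with ws False hd_hd_cut_after[of vs terminal] show ?thesis
      by (auto simp: decreasing_blocks_def)
  qed (auto simp: decreasing_blocks_def)
qed

text \<open>In preorder a nonterminal node is followed immediately by its right child, or by its
  left child if there is no right one, so the Bernardi condition compares neighbours within a
  factor. The tail \<open>vs\<close> serves the induction; no comparison reaches into it because the
  last node of \<open>T\<close> is terminal.\<close>

lemma decreasing_blocks_nodes_append:
  "decreasing_blocks (nodes T @ vs) \<longleftrightarrow> decreasing_blocks vs \<and>
     (\<forall>v \<in> set (nodes T). \<not> terminal v \<longrightarrow>
        (if right v \<noteq> \<langle>\<rangle> then value (right v) < value v else value (left v) < value v))"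
proof (induction T arbitrary: vs)
  case (Node l a r)
  then show ?case
    by (cases "l = \<langle>\<rangle>"; cases "r = \<langle>\<rangle>") (auto simp: terminal_def)
qed simp

lemma bernardi_trees_altdef:
  "bernardi_trees n = {T. size T = n \<and> distinct (preorder_word T) \<and> set (preorder_word T) = {1..n} \<and>
     (\<forall>w\<in>set (factors T). sorted_wrt (>) w)}"
  using decreasing_blocks_nodes_append[of _ "[]"]
  by (auto simp: bernardi_trees_def decreasing_blocks_def factors_def)

lemma concat_factors [simp]: "concat (factors T) = preorder_word T"
  by (simp add: factors_def preorder_word_def flip: map_concat)

lemma nodes_shape: "nodes (shape T) = map shape (nodes T)"
  by (induction T) auto

lemma terminal_shape: "terminal \<circ> shape = terminal"
proof
  show "(terminal \<circ> shape) T = terminal T" for T :: "'a tree"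
    by (cases T) (auto simp: terminal_def)
qed

lemma block_lengths_shape: "block_lengths (nodes (shape T)) = map length (factors T)"
  by (simp add: block_lengths_def nodes_shape cut_after_map terminal_shape factors_def)

lemma sum_list_block_lengths: "sum_list (block_lengths (nodes T)) = size T"
  by (metis block_lengths_def concat_cut_after length_concat length_map length_preorder_word preorder_word_def)

lemma concat_eq_imp_eq:
  "concat xs = concat ys \<Longrightarrow> map length xs = map length ys \<Longrightarrow> xs = ys"
proof (induction xs arbitrary: ys)
  case (Cons x xs)
  then show ?case by (cases ys) auto
qed simp

section \<open>Trees fixed by the action\<close>

definition decreasing_list :: "nat set \<Rightarrow> nat list" where
  "decreasing_list B = rev (sorted_list_of_set B)"

lemma decreasing_list_simps [simp]:
  "finite B \<Longrightarrow> set (decreasing_list B) = B" "length (decreasing_list B) = card B"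
  "distinct (decreasing_list B)" "sorted_wrt (>) (decreasing_list B)"
  by (simp_all add: decreasing_list_def sorted_wrt_rev)

lemma decreasing_list_set:
  assumes "sorted_wrt (>) w"
  shows "decreasing_list (set w) = w"
proof -
  have "sorted_wrt (<) (rev w)" using assms by (simp add: sorted_wrt_rev)
  then have "sorted_list_of_set (set (rev w)) = rev w"
    unfolding strict_sorted_iff by (intro sorted_list_of_set.idem_if_sorted_distinct) auto
  then show ?thesis by (simp add: decreasing_list_def)
qed

text \<open>A decreasing word carries the same information as its set of letters, and injectivity
  keeps the images distinct. The action on factors thereby becomes the image map on sets.\<close>

lemma apply_and_sort_decreasing:
  assumes "sorted_wrt (>) w" "inj \<sigma>"
  shows "apply_and_sort \<sigma> w = decreasing_list (\<sigma> ` set w)"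
proof -
  have "distinct w" using assms(1) by (metis distinct_rev sorted_wrt_rev strict_sorted_iff)
  then have "distinct (map \<sigma> w)"
    using assms(2) by (auto simp: distinct_map intro: inj_on_subset)
  then show ?thesis
    by (simp add: apply_and_sort_def decreasing_list_def sorted_list_of_set_sort_remdups
        distinct_remdups_id flip: set_map)
qed

text \<open>The action keeps the shape, so only the preorder words need comparison. Since
  \<open>apply_and_sort\<close> preserves lengths, equal words means equal factors, and a decreasing
  factor is determined by its set of letters.\<close>

lemma action_eq_self_iff:
  assumes "\<forall>w\<in>set (factors T). sorted_wrt (>) w" "inj \<sigma>"
  shows "action \<sigma> T = T \<longleftrightarrow> (\<forall>B\<in>set (map set (factors T)). \<sigma> ` B = B)"
proof -
  let ?w = "concat (map (apply_and_sort \<sigma>) (factors T))"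
  note ex1 = ex1_relabelling[of ?w T, OF length_action_word]
  have "action \<sigma> T = T \<longleftrightarrow> preorder_word T = ?w"
    using theI'[OF ex1] the1_equality[OF ex1] by (metis (no_types, lifting) action_def)
  also have "\<dots> \<longleftrightarrow> map (apply_and_sort \<sigma>) (factors T) = factors T"
    using concat_eq_imp_eq[of "map (apply_and_sort \<sigma>) (factors T)" "factors T"]
    by (auto simp: apply_and_sort_def)
  also have "\<dots> \<longleftrightarrow> (\<forall>w\<in>set (factors T). apply_and_sort \<sigma> w = w)"
    using map_eq_conv[of "apply_and_sort \<sigma>" "factors T" "\<lambda>w. w"] by simp
  also have "\<dots> \<longleftrightarrow> (\<forall>w\<in>set (factors T). \<sigma> ` set w = set w)"
  proof (rule ball_cong[OF refl])
    fix w assume w: "w \<in> set (factors T)"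
    with assms have s: "sorted_wrt (>) w" by auto
    show "apply_and_sort \<sigma> w = w \<longleftrightarrow> \<sigma> ` set w = set w"
      using apply_and_sort_decreasing[OF s assms(2)] decreasing_list_set[OF s]
        decreasing_list_simps(1)[of "\<sigma> ` set w"] by (metis finite_imageI finite_set)
  qed
  finally show ?thesis by simp
qed

text \<open>A shape is read as a forest with one tree; \<open>as \<noteq> []\<close> excludes the
  empty tree, which forests do not contain.\<close>

lemma card_shapes:
  assumes "as \<noteq> []"
  shows "card {s :: unit tree. block_lengths (nodes s) = as} = forest_count as 1"
    and finite_shapes_aux: "finite {s :: unit tree. block_lengths (nodes s) = as}"
proof -
  have bij: "bij_betw (\<lambda>s. [s]) {s. block_lengths (nodes s) = as} (forests as 1)"
  proof (rule bij_betw_byWitness[where f' = hd])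
    show "(\<lambda>s. [s]) ` {s. block_lengths (nodes s) = as} \<subseteq> forests as 1"
      using assms by (auto simp: forests_def)
    show "hd ` forests as 1 \<subseteq> {s. block_lengths (nodes s) = as}" "\<forall>ts\<in>forests as 1. [hd ts] = ts"
      by (auto simp: forests_def length_Suc_conv)
  qed simp
  show "card {s :: unit tree. block_lengths (nodes s) = as} = forest_count as 1"
    using bij_betw_same_card[OF bij] card_forests[of as 1] by simp
  show "finite {s :: unit tree. block_lengths (nodes s) = as}"
    using bij_betw_finite[OF bij] card_forests[of as 1] by blast
qed

lemma finite_shapes: "finite {s :: unit tree. block_lengths (nodes s) = as}"
  by (cases "as = []") (simp_all add: finite_shapes_aux)

text \<open>The list order records the order of the factors in preorder.\<close>

definition ordered_invariant_partitions :: "nat \<Rightarrow> (nat \<Rightarrow> nat) \<Rightarrow> nat set list set" where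
  "ordered_invariant_partitions n \<sigma> =
     (\<Union>P\<in>{P. partition_on {1..n} P \<and> (\<forall>B\<in>P. \<sigma> ` B = B)}. permutations_of_set P)"

lemma partition_on_blocks:
  assumes "distinct (concat xs)" "[] \<notin> set xs"
  shows "partition_on (set (concat xs)) (set ` set xs)" "distinct (map set xs)"
  using assms
proof (induction xs)
  case (Cons x xs)
  {
    case 1
    with Cons have IH: "partition_on (set (concat xs)) (set ` set xs)" "disjnt (set x) (\<Union>(set ` set xs))"
      by (auto simp: disjnt_def)
    then show ?case
      using partition_on_insert[OF IH(2), of "set (concat (x # xs))"] 1
      by (auto simp: Diff_triv Un_Diff disjnt_def Int_commute)
  next
    case 2
    then have "x \<noteq> []" "set x \<inter> \<Union>(set ` set xs) = {}" by auto
    have "set x \<notin> set ` set xs"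
    proof
      assume "set x \<in> set ` set xs"
      then have "set x \<subseteq> \<Union>(set ` set xs)" by (rule Union_upper)
      with \<open>set x \<inter> _ = {}\<close> have "set x = {}" by (simp add: Int_absorb2)
      with \<open>x \<noteq> []\<close> show False by simp
    qed
    with 2 Cons show ?case by auto
  }
qed (simp_all add: partition_on_empty)

text \<open>A fixed tree is encoded by the letter sets of its factors together with its shape. The
  tree is recovered by writing each block in decreasing order and placing the resulting word on the
  shape in preorder.\<close>

lemma card_fixed_bernardi_trees:
  assumes "\<sigma> permutes {1..n}"
  shows "card {T \<in> bernardi_trees n. action \<sigma> T = T} =
    (\<Sum>xs\<in>ordered_invariant_partitions n \<sigma>. card {s :: unit tree. block_lengths (nodes s) = map card xs})"
proof -
  let ?X = "{T \<in> bernardi_trees n. action \<sigma> T = T}"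
  let ?S = "\<lambda>xs. {s :: unit tree. block_lengths (nodes s) = map card xs}"
  let ?Y = "Sigma (ordered_invariant_partitions n \<sigma>) ?S"
  let ?f = "\<lambda>T. (map set (factors T), shape T)"
  have inj: "inj \<sigma>" using assms by (rule permutes_inj)
  have X: "T \<in> ?X \<longleftrightarrow> distinct (preorder_word T) \<and> set (preorder_word T) = {1..n} \<and>
      (\<forall>w\<in>set (factors T). sorted_wrt (>) w) \<and> (\<forall>B\<in>set (map set (factors T)). \<sigma> ` B = B)" for T
  proof -
    have "size T = n" if "distinct (preorder_word T)" "set (preorder_word T) = {1..n}"
      using distinct_card[OF that(1)] that(2) by simp
    then show ?thesis using action_eq_self_iff[OF _ inj, of T] by (auto simp: bernardi_trees_altdef)
  qed
  have "bij_betw ?f ?X ?Y"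
  proof (rule bij_betw_imageI)
    show "inj_on ?f ?X"
    proof (rule inj_onI)
      fix T U assume TU: "T \<in> ?X" "U \<in> ?X" "?f T = ?f U"
      have *: "factors V = map decreasing_list (map set (factors V))" if "V \<in> ?X" for V
      proof -
        have "decreasing_list (set w) = w" if "w \<in> set (factors V)" for w
          using that \<open>V \<in> ?X\<close> X[of V] by (blast intro: decreasing_list_set)
        then show ?thesis by (simp add: map_idI)
      qed
      have "map set (factors T) = map set (factors U)" using TU(3) by simp
      then have "factors T = factors U"
        by (subst *[OF TU(1)], subst *[OF TU(2)]) simp
      then have "preorder_word T = preorder_word U" by (simp flip: concat_factors)
      moreover have "shape T = shape U" using TU(3) by simp
      ultimately show "T = U" using ex1_relabelling[of "preorder_word T" T] by (metis length_preorder_word)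
    qed
    show "?f ` ?X = ?Y"
    proof (intro equalityI subsetI)
      fix y assume "y \<in> ?f ` ?X"
      then obtain T where T: "T \<in> ?X" "y = ?f T" by auto
      note TX = T(1)[unfolded X]
      have "[] \<notin> set (factors T)" by (auto simp: factors_def)
      moreover have "distinct (concat (factors T))" "set (concat (factors T)) = {1..n}"
        using TX by simp_all
      ultimately have p: "partition_on {1..n} (set ` set (factors T))" "distinct (map set (factors T))"
        using partition_on_blocks[of "factors T"] by metis+
      have "map set (factors T) \<in> permutations_of_set (set ` set (factors T))"
        using p(2) by (intro permutations_of_setI) simp_all
      moreover have "set ` set (factors T) \<in> {P. partition_on {1..n} P \<and> (\<forall>B\<in>P. \<sigma> ` B = B)}"
        using p(1) TX by simp
      ultimately have "map set (factors T) \<in> ordered_invariant_partitions n \<sigma>"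
        unfolding ordered_invariant_partitions_def by (rule UN_I[rotated])
      moreover have "distinct w" if "w \<in> set (factors T)" for w
        using \<open>distinct (concat (factors T))\<close> that by (simp only: distinct_concat_iff)
      then have "block_lengths (nodes (shape T)) = map card (map set (factors T))"
        by (simp add: block_lengths_shape distinct_card)
      ultimately show "y \<in> ?Y" using T(2) by simp
    next
      fix y assume "y \<in> ?Y"
      then obtain xs s P where y: "y = (xs, s)" "xs \<in> permutations_of_set P" "partition_on {1..n} P"
          "\<forall>B\<in>P. \<sigma> ` B = B" "block_lengths (nodes s) = map card xs"
        by (auto simp: ordered_invariant_partitions_def)
      then have xs: "set xs = P" "distinct xs" by (auto simp: permutations_of_set_def)
      have fin: "finite B" "B \<noteq> {}" if "B \<in> P" for B
        using y(3) that finite_subset[of B "{1..n}"] by (auto simp: partition_on_def)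
      define ws where "ws = map decreasing_list xs"
      have "length (concat ws) = size s"
        using sum_list_block_lengths[of s] by (simp add: y(5) ws_def length_concat comp_def)
      then obtain T :: "nat tree" where T: "shape T = shape s" "preorder_word T = concat ws"
        using ex1_relabelling by blast
      have "shape s = s" by (induction s) auto
      with T have T1: "shape T = s" by simp
      \<comment> \<open>The shape alone determines where the word is cut, and its factor lengths are
        the block sizes.\<close>
      have ws: "factors T = ws"
      proof (rule concat_eq_imp_eq)
        show "map length (factors T) = map length ws"
          using block_lengths_shape[of T] by (simp add: T1 y(5) ws_def comp_def)
      qed (simp add: T)
      have set_ws: "map set ws = xs"
        using fin xs by (auto simp: ws_def intro!: map_idI)
      have "distinct (concat ws)"
      proof (rule distinct_concat)
        show "distinct ws" using xs(2) set_ws by (metis distinct_map)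
        show "distinct w" if "w \<in> set ws" for w using that by (auto simp: ws_def)
        show "set v \<inter> set w = {}" if "v \<in> set ws" "w \<in> set ws" "v \<noteq> w" for v w
        proof -
          from that obtain B C where BC: "B \<in> P" "C \<in> P" "v = decreasing_list B" "w = decreasing_list C"
            using xs by (auto simp: ws_def)
          with that have "B \<noteq> C" by auto
          with BC y(3) fin show ?thesis by (auto simp: partition_on_def disjoint_def)
        qed
      qed
      moreover have "set (concat ws) = {1..n}"
        using y(3) xs set_ws by (metis partition_onD1 set_concat set_map)
      moreover have "\<forall>w\<in>set ws. sorted_wrt (>) w" by (auto simp: ws_def)
      ultimately have "T \<in> ?X"
        unfolding X T(2) ws set_ws using y(4) xs by blast
      moreover have "y = ?f T" using y(1) ws set_ws T1 by simp
      ultimately show "y \<in> ?f ` ?X" by blast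
    qed
  qed
  then have "card ?X = card ?Y" by (rule bij_betw_same_card)
  moreover have "card ?Y = (\<Sum>xs\<in>ordered_invariant_partitions n \<sigma>. card (?S xs))"
  proof (rule card_SigmaI)
    have "finite {P. partition_on {1..n} P \<and> (\<forall>B\<in>P. \<sigma> ` B = B)}"
      using finitely_many_partition_on[of "{1..n}"] by (auto intro: finite_subset[rotated])
    then show "finite (ordered_invariant_partitions n \<sigma>)"
      by (auto simp: ordered_invariant_partitions_def)
    show "\<forall>xs\<in>ordered_invariant_partitions n \<sigma>. finite (?S xs)" using finite_shapes by blast
  qed
  ultimately show ?thesis by simp
qed

section \<open>Assembling the count of fixed trees\<close>

theorem corollary5p11:
  fixes n k :: nat and \<sigma> :: "nat \<Rightarrow> nat"
  assumes "n \<ge> 1"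
    and "\<sigma> permutes {1..n}"
    and "num_cycles n \<sigma> = k"
  shows "real (card {T \<in> bernardi_trees n. action \<sigma> T = T}) =
    1 / 2 ^ k * (\<Sum>m = 1..n + 1. real m ^ (k - 1) * real (n choose (m - 1)))"
proof -
  \<comment> \<open>The value of \<open>sum_forest_count\<close> for a single tree
    (\<open>r = 1\<close>) with \<open>j\<close> factors: \<open>n - j\<close> nonterminal nodes, of
    which \<open>j - 1\<close> have two children.\<close>
  define g where "g j = fact (j - 1) * ((n - j) choose (j - 1)) * 2 ^ (n - j - (j - 1))" for j
  let ?\<P> = "{P. partition_on {1..n} P \<and> (\<forall>B\<in>P. \<sigma> ` B = B)}"
  have k: "card (orbit \<sigma> ` {1..n}) = k" using assms(3) by (simp add: num_cycles_def)
  have "k \<le> n" using card_image_le[of "{1..n}" "orbit \<sigma>"] k by simp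
  moreover have "k \<noteq> 0"
    unfolding k[symmetric] using assms(1) by (subst card_0_eq) auto
  ultimately have kn: "1 \<le> k" "k \<le> n" by auto
  have fin: "finite ?\<P>"
    using finitely_many_partition_on[of "{1..n}"] by (auto intro: finite_subset[rotated])
  have "card {T \<in> bernardi_trees n. action \<sigma> T = T} =
      (\<Sum>xs\<in>ordered_invariant_partitions n \<sigma>. forest_count (map card xs) 1)"
    unfolding card_fixed_bernardi_trees[OF assms(2)]
  proof (rule sum.cong)
    fix xs assume "xs \<in> ordered_invariant_partitions n \<sigma>"
    then have "\<Union>(set xs) = {1..n}"
      by (auto simp: ordered_invariant_partitions_def permutations_of_set_def partition_on_def)
    with assms(1) have "map card xs \<noteq> []" by auto
    then show "card {s :: unit tree. block_lengths (nodes s) = map card xs} = forest_count (map card xs) 1"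
      by (rule card_shapes)
  qed simp
  also have "\<dots> = (\<Sum>P\<in>?\<P>. \<Sum>xs\<in>permutations_of_set P. forest_count (map card xs) 1)"
    unfolding ordered_invariant_partitions_def
    by (rule sum.UNION_disjoint) (use fin in \<open>auto dest: permutations_of_setD\<close>)
  also have "\<dots> = (\<Sum>P\<in>?\<P>. g (card P))"
  proof (rule sum.cong)
    fix P assume "P \<in> ?\<P>"
    then have P: "partition_on {1..n} P" by simp
    have finB: "finite B" if "B \<in> P" for B
      using partition_on_remove(2)[OF P that] finite_subset by blast
    have P1: "finite P" "P \<noteq> {}"
      using finite_elements[OF _ P] partition_onD1[OF P] assms(1) by auto
    have P2: "sum card P = n"
      using product_partition[OF P finB] by simp
    have P3: "card B \<ge> 1" if "B \<in> P" for B
      using partition_on_remove(3)[OF P that] finB[OF that] by (simp add: Suc_le_eq card_gt_0_iff)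
    have "card P \<le> n" using sum_mono[of P "\<lambda>_. 1" card] P2 P3 by simp
    with sum_forest_count[where s = card, OF P1 P3, of 1]
    show "(\<Sum>xs\<in>permutations_of_set P. forest_count (map card xs) 1) = g (card P)"
      using P1 P2 by (simp add: g_def Let_def Suc_le_eq card_gt_0_iff)
  qed simp
  also have "\<dots> = (\<Sum>j\<le>k. Stirling k j * g j)"
    by (rule sum_invariant_partition_on[OF assms(2) _ k]) simp
  \<comment> \<open>The added terms vanish since \<open>Stirling k j = 0\<close> for
    \<open>j > k\<close>; the next step drops \<open>j = 0\<close>, where
    \<open>Stirling k 0 = 0\<close> because \<open>k \<ge> 1\<close>.\<close>
  also have "\<dots> = (\<Sum>j\<le>n. Stirling k j * g j)"
    using kn(2) by (intro sum.mono_neutral_left) auto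
  also have "\<dots> = (\<Sum>i\<le>n - 1. Stirling k (Suc i) * g (Suc i))"
  proof -
    obtain m l where "n = Suc m" "k = Suc l" using kn by (metis Suc_le_D One_nat_def le_trans)
    then show ?thesis by (simp add: sum.atMost_Suc_shift del: sum.atMost_Suc)
  qed
  also have "\<dots> = (\<Sum>i\<le>n - 1. ((n - 1 - i) choose i) * 2 ^ (n - 1 - 2 * i) * (Stirling k (Suc i) * fact i))"
    by (simp add: g_def mult_ac mult_2_right)
  finally show ?thesis
    unfolding sum_power_binomial_Stirling[OF kn] by simp
qed

end
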